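(* Let $N\ge1$ be an integer, let $a\neq0$ be a constant (lattice parameter), and let $\varphi_i^{(n)}(k)=\varphi_i^{(n)}(k,T,S)$, $1\le i\le N$, $n\in\mathbb{Z}$, $k\in\mathbb{Z}$ (discrete site index), be smooth functions of $(T,S)$ satisfying the linear dispersion relations $$\frac{\varphi_i^{(n)}(k)-\varphi_i^{(n)}(k-1)}{a}=\varphi_i^{(n+1)}(k),\qquad \frac{\partial\varphi_i^{(n)}(k)}{\partial T}=\varphi_i^{(n-1)}(k),\qquad \frac{\partial\varphi_i^{(n)}(k)}{\partial S}=\varphi_i^{(n-2)}(k).$$ Let $$\tau_n(k)=\det\bigl(\varphi_i^{(n+j-1)}(k)\bigr)_{1\le i,j\le N},\qquad f_k=\tau_0(k),\quad g_k=\tau_1(k).$$ Then for every $k$ the bilinear equations $$(D_T^2+D_S)\,g_k\cdot f_k=0,\qquad (D_T^2+D_S-2aD_T)\,g_k\cdot f_{k-1}=0$$ hold. In particular, for nonzero constants $p_i,q_i$ with $ap_i\neq1$, $aq_i\neq1$ and arbitrary constants $\xi_{i,0},\eta_{i,0}$, the functions $$\varphi_i^{(n)}(k)=p_i^{n}(1-ap_i)^{-k}e^{\frac1{p_i}T+\frac1{p_i^2}S+\xi_{i,0}}+q_i^{n}(1-aq_i)^{-k}e^{\frac1{q_i}T+\frac1{q_i^2}S+\eta_{i,0}}$$ satisfy the linear dispersion relations, and so yield a solution (the $N$-soliton solution) of the bilinear equations.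
   Context: Hirota bilinear operators: for smooth functions $g,f$ of $(T,S)$, $$D_T^mD_S^r\,g\cdot f=\left.(\partial_T-\partial_{T'})^m(\partial_S-\partial_{S'})^r\,g(T,S)f(T',S')\right|_{T'=T,\,S'=S},$$ extended linearly to polynomials in $D_T,D_S$. Here $T,S$ are real variables; functions and constants may be real- or complex-valued. *)

theory Defs
  imports
    "HOL-Analysis.Derivative"
    "HOL-Computational_Algebra.Polynomial"
    "Jordan_Normal_Form.Determinant"
begin

text \<open>
  The value type \<open>'a::{real_normed_field,banach}\<close> covers both real- and complex-valued functions and
  constants; the variables \<open>T\<close> and \<open>S\<close> are always real.
\<close>

definition partial_T :: "(real \<Rightarrow> real \<Rightarrow> 'a::real_normed_vector) \<Rightarrow> real \<Rightarrow> real \<Rightarrow> 'a" where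
  "partial_T f = (\<lambda>T S. vector_derivative (\<lambda>t. f t S) (at T))"

definition partial_S :: "(real \<Rightarrow> real \<Rightarrow> 'a::real_normed_vector) \<Rightarrow> real \<Rightarrow> real \<Rightarrow> 'a" where
  "partial_S f = (\<lambda>T S. vector_derivative (\<lambda>s. f T s) (at S))"

fun C_k :: "nat \<Rightarrow> (real \<Rightarrow> real \<Rightarrow> 'a::real_normed_vector) \<Rightarrow> bool" where
  "C_k 0 f \<longleftrightarrow> continuous_on UNIV (\<lambda>(T, S). f T S)"
| "C_k (Suc m) f \<longleftrightarrow>
     (\<forall>T S. (\<lambda>t. f t S) differentiable at T \<and> (\<lambda>s. f T s) differentiable at S) \<and>
     C_k m (partial_T f) \<and> C_k m (partial_S f)"

definition smooth :: "(real \<Rightarrow> real \<Rightarrow> 'a::real_normed_vector) \<Rightarrow> bool" where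
  "smooth f \<longleftrightarrow> (\<forall>m. C_k m f)"


text \<open>
  The operators \<open>\<partial>\<^sub>T - \<partial>\<^sub>T\<^sub>'\<close> and \<open>\<partial>\<^sub>S - \<partial>\<^sub>S\<^sub>'\<close>
  act on functions of the four variables \<open>T, S, T', S'\<close>, in this order.
\<close>

definition diff_T ::
  "(real \<Rightarrow> real \<Rightarrow> real \<Rightarrow> real \<Rightarrow> 'a::real_normed_vector) \<Rightarrow> real \<Rightarrow> real \<Rightarrow> real \<Rightarrow> real \<Rightarrow> 'a" where
  "diff_T F = (\<lambda>T S T' S'. vector_derivative (\<lambda>t. F t S T' S') (at T)
                           - vector_derivative (\<lambda>t. F T S t S') (at T'))"

definition diff_S ::
  "(real \<Rightarrow> real \<Rightarrow> real \<Rightarrow> real \<Rightarrow> 'a::real_normed_vector) \<Rightarrow> real \<Rightarrow> real \<Rightarrow> real \<Rightarrow> real \<Rightarrow> 'a" where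
  "diff_S F = (\<lambda>T S T' S'. vector_derivative (\<lambda>s. F T s T' S') (at S)
                           - vector_derivative (\<lambda>s. F T S T' s) (at S'))"

definition hirota_monom ::
  "nat \<Rightarrow> nat \<Rightarrow> (real \<Rightarrow> real \<Rightarrow> 'a::real_normed_field) \<Rightarrow> (real \<Rightarrow> real \<Rightarrow> 'a) \<Rightarrow> real \<Rightarrow> real \<Rightarrow> 'a" where
  "hirota_monom m r g f T S =
     (diff_T ^^ m) ((diff_S ^^ r) (\<lambda>T S T' S'. g T S * f T' S')) T S T S"

text \<open>
  A polynomial in \<open>D\<^sub>T, D\<^sub>S\<close> is encoded as a polynomial in \<open>D\<^sub>T\<close> whose coefficients are
  polynomials in \<open>D\<^sub>S\<close>; a scalar \<open>c\<close> is \<open>[:[:c:]:]\<close>.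
\<close>

definition D_T :: "'a::comm_ring_1 poly poly" where
  "D_T = monom 1 1"

definition D_S :: "'a::comm_ring_1 poly poly" where
  "D_S = [:monom 1 1:]"

definition hirota ::
  "'a::real_normed_field poly poly \<Rightarrow> (real \<Rightarrow> real \<Rightarrow> 'a) \<Rightarrow> (real \<Rightarrow> real \<Rightarrow> 'a) \<Rightarrow> real \<Rightarrow> real \<Rightarrow> 'a" where
  "hirota P g f T S =
     (\<Sum>m\<le>degree P. \<Sum>r\<le>degree (coeff P m). coeff (coeff P m) r * hirota_monom m r g f T S)"


text \<open>
  A family \<open>\<phi>\<close> takes its arguments in the order \<open>i, n, k, T, S\<close>; only the indices \<open>1 \<le> i \<le> N\<close> matter.
\<close>

type_synonym 'a family = "nat \<Rightarrow> int \<Rightarrow> int \<Rightarrow> real \<Rightarrow> real \<Rightarrow> 'a"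

definition smooth_family :: "nat \<Rightarrow> 'a::real_normed_field family \<Rightarrow> bool" where
  "smooth_family N \<phi> \<longleftrightarrow> (\<forall>i\<in>{1..N}. \<forall>n k. smooth (\<phi> i n k))"

definition dispersion_relations :: "nat \<Rightarrow> 'a \<Rightarrow> 'a::real_normed_field family \<Rightarrow> bool" where
  "dispersion_relations N a \<phi> \<longleftrightarrow>
     (\<forall>i\<in>{1..N}. \<forall>n k T S.
        (\<phi> i n k T S - \<phi> i n (k - 1) T S) / a = \<phi> i (n + 1) k T S \<and>
        ((\<lambda>t. \<phi> i n k t S) has_vector_derivative \<phi> i (n - 1) k T S) (at T) \<and>
        ((\<lambda>s. \<phi> i n k T s) has_vector_derivative \<phi> i (n - 2) k T S) (at S))"

text \<open>
  Matrix indices start at \<open>0\<close>, so the entry at \<open>(i, j)\<close> below is the entry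
  \<open>\<phi>\<^sub>i\<^sub>+\<^sub>1\<close> with upper index \<open>n + (j + 1) - 1\<close> of the one-based matrix.
\<close>

definition tau :: "nat \<Rightarrow> 'a::real_normed_field family \<Rightarrow> int \<Rightarrow> int \<Rightarrow> real \<Rightarrow> real \<Rightarrow> 'a" where
  "tau N \<phi> n k T S =
     Determinant.det (Matrix.mat N N (\<lambda>(i, j). \<phi> (i + 1) (n + int j) k T S))"

definition bilinear_equations ::
  "'a::real_normed_field \<Rightarrow> (int \<Rightarrow> real \<Rightarrow> real \<Rightarrow> 'a) \<Rightarrow> (int \<Rightarrow> real \<Rightarrow> real \<Rightarrow> 'a) \<Rightarrow> bool" where
  "bilinear_equations a f g \<longleftrightarrow>
     (\<forall>k T S. hirota (D_T ^ 2 + D_S) (g k) (f k) T S = 0 \<and>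
              hirota (D_T ^ 2 + D_S - [:[:2 * a:]:] * D_T) (g k) (f (k - 1)) T S = 0)"

definition soliton ::
  "'a \<Rightarrow> (nat \<Rightarrow> 'a) \<Rightarrow> (nat \<Rightarrow> 'a) \<Rightarrow> (nat \<Rightarrow> 'a) \<Rightarrow> (nat \<Rightarrow> 'a) \<Rightarrow> 'a::{real_normed_field,banach} family" where
  "soliton a p q \<xi> \<eta> i n k T S =
     p i powi n * (1 - a * p i) powi (- k)
       * exp (1 / p i * of_real T + 1 / (p i)\<^sup>2 * of_real S + \<xi> i)
     + q i powi n * (1 - a * q i) powi (- k)
       * exp (1 / q i * of_real T + 1 / (q i)\<^sup>2 * of_real S + \<eta> i)"

end

theory Submission
  imports Defs
begin

text \<open>
  Write \<open>c\<^sub>n\<close> for the vector \<open>(\<phi>\<^sub>i\<^sup>(\<^sup>n\<^sup>)(k))\<^sub>i\<close>. Differentiating \<open>\<tau>\<^sub>n\<close> lowers one column index at a time, and all but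
  the first one or two terms vanish because of a repeated column. Hence \<open>g\<^sub>T\<^sub>T + g\<^sub>S = 2 |c\<^sub>-\<^sub>1, c\<^sub>2, \<dots>, c\<^sub>N|\<close>
  and \<open>f\<^sub>T\<^sub>T - f\<^sub>S = 2 |c\<^sub>-\<^sub>1, c\<^sub>0, c\<^sub>2, \<dots>, c\<^sub>N\<^sub>-\<^sub>1|\<close>, and the first bilinear equation becomes a three-term
  Pluecker relation. For the second one, \<open>f\<^sub>k\<^sub>-\<^sub>1\<close> has the columns \<open>d\<^sub>n = c\<^sub>n - a c\<^sub>n\<^sub>+\<^sub>1\<close>; exchanging \<open>d\<^sub>-\<^sub>1\<close>
  into \<open>f\<^sub>k\<^sub>-\<^sub>1\<close> again leaves only two terms, since \<open>|d\<^sub>j, c\<^sub>2, \<dots>, c\<^sub>N| = 0\<close> for \<open>2 \<le> j < N\<close>. Both equations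
  are instances of one identity with \<open>d\<^sub>n = c\<^sub>n - b c\<^sub>n\<^sub>+\<^sub>1\<close>, namely \<open>b = 0\<close> and \<open>b = a\<close>.
\<close>

section \<open>Determinants as functions of their rows\<close>

text \<open>Rows are kept as functions so that replacing row \<open>i\<close> is the plain update
  \<open>c(i := w)\<close>.\<close>

definition row_det :: "nat \<Rightarrow> (nat \<Rightarrow> nat \<Rightarrow> 'a::comm_ring_1) \<Rightarrow> 'a" where
  "row_det N c = Determinant.det (Matrix.mat N N (\<lambda>(i, j). c i j))"

lemma row_det_cong:
  assumes "\<And>i j. i < N \<Longrightarrow> j < N \<Longrightarrow> c i j = d i j"
  shows "row_det N c = row_det N d"
proof -
  have "Matrix.mat N N (\<lambda>(i, j). c i j) = Matrix.mat N N (\<lambda>(i, j). d i j)"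
    using assms by (intro eq_matI) auto
  then show ?thesis by (simp add: row_det_def)
qed

lemma row_det_permutation_expansion:
  "row_det N c = (\<Sum>p | p permutes {0..<N}. signof p * (\<Prod>i=0..<N. c i (p i)))"
proof -
  have "(\<Prod>i=0..<N. Matrix.mat N N (\<lambda>(i, j). c i j) $$ (i, p i)) = (\<Prod>i=0..<N. c i (p i))"
    if "p permutes {0..<N}" for p
    using permutes_in_image[OF that] by (intro prod.cong) auto
  then show ?thesis
    unfolding row_det_def by (subst det_def'[of _ N]) (auto intro!: sum.cong)
qed

lemma row_det_identical_rows:
  assumes "i < N" "j < N" "i \<noteq> j" "c i = c j"
  shows "row_det N c = 0"
  unfolding row_det_def
  using assms by (intro det_identical_rows[of _ N i j]) (auto intro!: eq_vecI)

lemma row_det_swap_rows: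
  assumes "i < N" "j < N" "i \<noteq> j"
  shows "row_det N (c(i := x, j := y)) = - row_det N (c(i := y, j := x))"
proof -
  let ?A = "Matrix.mat N N (\<lambda>(l, m). (c(i := y, j := x)) l m)"
  have "Matrix.mat N N (\<lambda>(l, m). (c(i := x, j := y)) l m) = swaprows i j ?A"
    using assms by (intro eq_matI) auto
  then show ?thesis
    unfolding row_det_def using det_swaprows[of i N j ?A] assms by (simp del: fun_upd_apply)
qed

text \<open>The cofactors along row \<open>i\<close> do not see row \<open>i\<close>, so those of
  the original matrix serve for every \<open>w\<close>, and the determinant is a linear functional
  of \<open>w\<close>.\<close>

lemma row_det_upd_laplace:
  assumes "i < N"
  shows "row_det N (c(i := w)) =
    (\<Sum>j<N. w j * cofactor (Matrix.mat N N (\<lambda>(i, j). c i j)) i j)"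
proof -
  let ?A = "Matrix.mat N N (\<lambda>(l, m). (c(i := w)) l m)"
  have "mat_delete ?A i j = mat_delete (Matrix.mat N N (\<lambda>(i, j). c i j)) i j" for j
    using assms unfolding mat_delete_def by (intro eq_matI) auto
  then have "cofactor ?A i j = cofactor (Matrix.mat N N (\<lambda>(i, j). c i j)) i j" for j
    unfolding cofactor_def by (rule arg_cong)
  moreover have "?A $$ (i, j) = w j" if "j < N" for j
    using assms that by simp
  ultimately show ?thesis
    unfolding row_det_def using assms
    by (subst laplace_expansion_row[of _ N i]) (auto intro!: sum.cong simp del: fun_upd_apply)
qed

text \<open>Cramer's rule without division: contract \<open>adj A * A = det A * 1\<close> with
  \<open>w\<close> and read each sum over cofactors as a determinant with one row replaced.\<close>

lemma row_det_cramer: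
  assumes i: "i < N"
  shows "(\<Sum>j<N. row_det N (c(j := w)) * c j i) = row_det N c * w i"
proof -
  let ?A = "Matrix.mat N N (\<lambda>(i, j). c i j)"
  have A: "?A \<in> carrier_mat N N" by simp
  have adj: "(\<Sum>j<N. cofactor ?A j l * c j i) = (if l = i then row_det N c else 0)" if "l < N" for l
  proof -
    have "(adj_mat ?A * ?A) $$ (l, i) = (\<Sum>j<N. cofactor ?A j l * c j i)"
      using i that adj_mat(1)[OF A]
      by (auto simp: adj_mat_def scalar_prod_def lessThan_atLeast0 intro!: sum.cong)
    then show ?thesis
      using adj_mat(3)[OF A] i that by (auto simp: row_det_def)
  qed
  have "(\<Sum>j<N. row_det N (c(j := w)) * c j i)
      = (\<Sum>j<N. \<Sum>l<N. w l * (cofactor ?A j l * c j i))"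
    by (intro sum.cong refl) (simp add: row_det_upd_laplace sum_distrib_right mult.assoc)
  also have "\<dots> = (\<Sum>l<N. w l * (\<Sum>j<N. cofactor ?A j l * c j i))"
    by (subst sum.swap) (simp add: sum_distrib_left)
  also have "\<dots> = (\<Sum>l<N. w l * (if l = i then row_det N c else 0))"
    by (intro sum.cong) (auto simp: adj)
  also have "\<dots> = row_det N c * w i"
    using i by (simp add: if_distrib cong: if_cong)
  finally show ?thesis .
qed

text \<open>The Pluecker exchange relation: expand \<open>w\<close> in the rows of \<open>c\<close> by Cramer's rule.\<close>

lemma row_det_exchange:
  assumes i: "i < N"
  shows "row_det N c * row_det N (r(i := w)) =
    (\<Sum>j<N. row_det N (c(j := w)) * row_det N (r(i := c j)))"
proof -
  let ?K = "cofactor (Matrix.mat N N (\<lambda>(i, j). r i j)) i"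
  have "row_det N c * row_det N (r(i := w)) = (\<Sum>l<N. row_det N c * w l * ?K l)"
    by (simp add: row_det_upd_laplace[OF i] sum_distrib_left mult.assoc)
  also have "\<dots> = (\<Sum>l<N. (\<Sum>j<N. row_det N (c(j := w)) * c j l) * ?K l)"
    by (intro sum.cong) (auto simp: row_det_cramer)
  also have "\<dots> = (\<Sum>j<N. row_det N (c(j := w)) * (\<Sum>l<N. c j l * ?K l))"
    by (subst sum_distrib_right, subst sum.swap) (simp add: sum_distrib_left mult.assoc)
  finally show ?thesis by (simp add: row_det_upd_laplace[OF i])
qed

lemma row_det_upd_diff:
  assumes "i < N"
  shows "row_det N (c(i := (\<lambda>j. x j - b * y j))) =
    row_det N (c(i := x)) - b * row_det N (c(i := y))"
  by (simp add: row_det_upd_laplace[OF assms] algebra_simps sum_subtractf sum_distrib_left)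

text \<open>The product rule is applied to each term of the permutation expansion; swapping the two
  sums then reassembles determinants with one differentiated row.\<close>

lemma has_vector_derivative_row_det:
  fixes c :: "real \<Rightarrow> nat \<Rightarrow> nat \<Rightarrow> 'a::real_normed_field"
  assumes "\<And>i j. i < N \<Longrightarrow> j < N \<Longrightarrow> ((\<lambda>t. c t i j) has_vector_derivative c' i j) (at x)"
  shows "((\<lambda>t. row_det N (c t)) has_vector_derivative (\<Sum>i<N. row_det N ((c x)(i := c' i)))) (at x)"
proof -
  have der: "((\<lambda>t. \<Prod>i=0..<N. c t i (p i)) has_vector_derivative
      (\<Sum>i<N. \<Prod>l=0..<N. ((c x)(i := c' i)) l (p l))) (at x)"
    if p: "p permutes {0..<N}" for p
  proof -
    have "((\<lambda>t. c t i (p i)) has_derivative (\<lambda>h. h *\<^sub>R c' i (p i))) (at x)" if "i \<in> {0..<N}" for i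
      using assms[of i "p i"] permutes_in_image[OF p, of i] that
      by (simp add: has_vector_derivative_def)
    then have "((\<lambda>t. \<Prod>i=0..<N. c t i (p i)) has_derivative
        (\<lambda>h. \<Sum>i=0..<N. (h *\<^sub>R c' i (p i)) * (\<Prod>j\<in>{0..<N} - {i}. c x j (p j)))) (at x)"
      by (rule has_derivative_prod)
    moreover have "(\<Prod>l=0..<N. ((c x)(i := c' i)) l (p l)) =
        c' i (p i) * (\<Prod>j\<in>{0..<N} - {i}. c x j (p j))" if "i \<in> {0..<N}" for i
      using that by (subst prod.remove[of _ i]) auto
    ultimately show ?thesis
      by (simp add: has_vector_derivative_def scaleR_sum_right lessThan_atLeast0)
  qed
  have "((\<lambda>t. row_det N (c t)) has_vector_derivative
     (\<Sum>p | p permutes {0..<N}. signof p * (\<Sum>i<N. \<Prod>l=0..<N. ((c x)(i := c' i)) l (p l)))) (at x)"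
    unfolding row_det_permutation_expansion
    by (intro has_vector_derivative_sum has_vector_derivative_mult_right der) simp
  also have "(\<Sum>p | p permutes {0..<N}. signof p * (\<Sum>i<N. \<Prod>l=0..<N. ((c x)(i := c' i)) l (p l)))
      = (\<Sum>i<N. row_det N ((c x)(i := c' i)))"
    unfolding row_det_permutation_expansion sum_distrib_left by (rule sum.swap)
  finally show ?thesis .
qed

section \<open>The quadratic identity behind both equations\<close>

lemma sum_lessThan_first_two:
  fixes h :: "nat \<Rightarrow> 'a::comm_monoid_add"
  assumes "N \<ge> 1" "\<And>j. 2 \<le> j \<Longrightarrow> j < N \<Longrightarrow> h j = 0"
  shows "(\<Sum>j<N. h j) = h 0 + (if N \<ge> 2 then h 1 else 0)"
proof (cases "N \<ge> 2")
  case True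
  then have "(\<Sum>j<N. h j) = (\<Sum>j\<in>{0, 1}. h j)"
    by (intro sum.mono_neutral_right) (auto intro!: assms(2))
  then show ?thesis using True by simp
next
  case False
  with assms(1) have "N = 1" by simp
  then show ?thesis by simp
qed

text \<open>This is the exchange relation that moves \<open>d (- 1)\<close> into the rows
  \<open>d 0, ..., d (N - 1)\<close>, against the determinants \<open>B u\<close> with rows
  \<open>u, c 2, ..., c N\<close>. Only the exchanges with \<open>d 0\<close> and \<open>d 1\<close>
  survive.\<close>

lemma row_det_bilinear:
  fixes c d :: "int \<Rightarrow> nat \<Rightarrow> 'a::comm_ring_1"
  assumes N: "N \<ge> 1" and d: "\<And>n. d n = (\<lambda>i. c n i - b * c (n + 1) i)"
  defines "B \<equiv> \<lambda>u. row_det N ((\<lambda>j. c (1 + int j))(0 := u))"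
    and "F \<equiv> row_det N (\<lambda>j. d (int j))"
    and "F1 \<equiv> row_det N ((\<lambda>j. d (int j))(0 := d (- 1)))"
    and "V \<equiv> if N \<ge> 2 then row_det N ((\<lambda>j. d (int j))(0 := d (- 1), 1 := d 0)) else 0"
  shows "(B (c (- 1)) - b * B (c 0)) * F - (B (c 0) - b * B (c 1)) * F1 + B (c 1) * V = 0"
proof -
  let ?M = "\<lambda>j. d (int j)"
  have Bd: "B (d n) = B (c n) - b * B (c (n + 1))" for n
    using N row_det_upd_diff[of 0 N "\<lambda>j. c (1 + int j)" "c n" b "c (n + 1)"]
    by (simp add: B_def d)
  \<comment> \<open>Here \<open>c j\<close> already occurs as row \<open>j - 1\<close>. The case
    \<open>j = N\<close> is included because \<open>d (N - 1)\<close> involves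
    \<open>c N\<close>.\<close>
  have Bc: "B (c (int j)) = 0" if "2 \<le> j" "j \<le> N" for j
    unfolding B_def using that by (intro row_det_identical_rows[of 0 N "j - 1"]) (auto simp: of_nat_diff)
  have "F * B (d (- 1)) = (\<Sum>j<N. row_det N (?M(j := d (- 1))) * B (?M j))"
    unfolding F_def B_def using N by (intro row_det_exchange) simp
  also have "\<dots> = F1 * B (d 0) + (if N \<ge> 2 then row_det N (?M(1 := d (- 1))) * B (d 1) else 0)"
  proof (subst sum_lessThan_first_two[OF N])
    show "row_det N (?M(j := d (- 1))) * B (?M j) = 0" if "2 \<le> j" "j < N" for j
      using Bd[of "int j"] Bc[of j] Bc[of "Suc j"] that by (simp add: add.commute)
  qed (simp add: F1_def)
  also have "(if N \<ge> 2 then row_det N (?M(1 := d (- 1))) * B (d 1) else 0) = - V * B (c 1)"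
  proof (cases "N \<ge> 2")
    case True
    \<comment> \<open>Naming row 0 explicitly lets the swap lemma produce the sign of
      \<open>V\<close>; moreover \<open>B (d 1) = B (c 1)\<close> because
      \<open>B (c 2) = 0\<close>.\<close>
    have "?M(1 := d (- 1)) = ?M(0 := d 0, 1 := d (- 1))" by auto
    then show ?thesis
      using True Bd[of 1] Bc[of 2] row_det_swap_rows[of 0 N 1 ?M "d 0" "d (- 1)"]
      by (simp add: V_def)
  qed (simp add: V_def)
  finally show ?thesis
    using Bd[of "- 1"] Bd[of 0] by (simp add: algebra_simps)
qed

section \<open>Hirota operators of low order\<close>

lemma diff_T_eq:
  assumes "\<And>T S T' S'. ((\<lambda>t. F t S T' S') has_vector_derivative A T S T' S') (at T)"
    and "\<And>T S T' S'. ((\<lambda>t. F T S t S') has_vector_derivative B T S T' S') (at T')"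
  shows "diff_T F = (\<lambda>T S T' S'. A T S T' S' - B T S T' S')"
  unfolding diff_T_def using assms[THEN vector_derivative_at] by simp

lemma diff_S_eq:
  assumes "\<And>T S T' S'. ((\<lambda>s. F T s T' S') has_vector_derivative A T S T' S') (at S)"
    and "\<And>T S T' S'. ((\<lambda>s. F T S T' s) has_vector_derivative B T S T' S') (at S')"
  shows "diff_S F = (\<lambda>T S T' S'. A T S T' S' - B T S T' S')"
  unfolding diff_S_def using assms[THEN vector_derivative_at] by simp

lemma hirota_monom_T:
  assumes g: "\<And>T S. ((\<lambda>t. g t S) has_vector_derivative g1 T S) (at T)"
    and f: "\<And>T S. ((\<lambda>t. f t S) has_vector_derivative f1 T S) (at T)"
  shows "hirota_monom 1 0 g f T S = g1 T S * f T S - g T S * f1 T S"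
proof -
  have "diff_T (\<lambda>T S T' S'. g T S * f T' S') =
      (\<lambda>T S T' S'. g1 T S * f T' S' - g T S * f1 T' S')"
    by (intro diff_T_eq has_vector_derivative_mult_left has_vector_derivative_mult_right g f)
  then show ?thesis by (simp add: hirota_monom_def)
qed

lemma hirota_monom_TT:
  assumes g: "\<And>T S. ((\<lambda>t. g t S) has_vector_derivative g1 T S) (at T)"
    and g1: "\<And>T S. ((\<lambda>t. g1 t S) has_vector_derivative g2 T S) (at T)"
    and f: "\<And>T S. ((\<lambda>t. f t S) has_vector_derivative f1 T S) (at T)"
    and f1: "\<And>T S. ((\<lambda>t. f1 t S) has_vector_derivative f2 T S) (at T)"
  shows "hirota_monom 2 0 g f T S = g2 T S * f T S - 2 * g1 T S * f1 T S + g T S * f2 T S"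
proof -
  \<comment> \<open>The first application is needed as a function of all four variables, since the
    primed ones are identified with the others only after the second.\<close>
  have 1: "diff_T (\<lambda>T S T' S'. g T S * f T' S') =
      (\<lambda>T S T' S'. g1 T S * f T' S' - g T S * f1 T' S')"
    by (intro diff_T_eq has_vector_derivative_mult_left has_vector_derivative_mult_right g f)
  have 2: "diff_T (\<lambda>T S T' S'. g1 T S * f T' S' - g T S * f1 T' S') =
      (\<lambda>T S T' S'. (g2 T S * f T' S' - g1 T S * f1 T' S') - (g1 T S * f1 T' S' - g T S * f2 T' S'))"
    by (intro diff_T_eq has_vector_derivative_diff has_vector_derivative_mult_left
        has_vector_derivative_mult_right g f g1 f1)
  show ?thesis
    by (simp add: hirota_monom_def numeral_2_eq_2 1 2)
qed

lemma hirota_monom_S: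
  assumes g: "\<And>T S. ((\<lambda>s. g T s) has_vector_derivative g1 T S) (at S)"
    and f: "\<And>T S. ((\<lambda>s. f T s) has_vector_derivative f1 T S) (at S)"
  shows "hirota_monom 0 1 g f T S = g1 T S * f T S - g T S * f1 T S"
proof -
  have "diff_S (\<lambda>T S T' S'. g T S * f T' S') =
      (\<lambda>T S T' S'. g1 T S * f T' S' - g T S * f1 T' S')"
    by (intro diff_S_eq has_vector_derivative_mult_left has_vector_derivative_mult_right g f)
  then show ?thesis by (simp add: hirota_monom_def)
qed

lemma hirota_quadratic:
  "hirota (D_T ^ 2 + D_S - [:[:c:]:] * D_T) g f T S =
    hirota_monom 0 1 g f T S - c * hirota_monom 1 0 g f T S + hirota_monom 2 0 g f T S"
proof -
  \<comment> \<open>Outer positions count powers of \<open>D_T\<close>, inner ones powers of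
    \<open>D_S\<close>: the constant outer coefficient \<open>[:0, 1:]\<close> is
    \<open>D_S\<close>.\<close>
  have "D_T ^ 2 + D_S - [:[:c:]:] * D_T = [:[:0, 1:], [:- c:], 1:]"
    by (simp add: D_T_def D_S_def power2_eq_square monom_Suc monom_0 one_pCons)
  then show ?thesis
    by (simp add: hirota_def numeral_2_eq_2)
qed

section \<open>Casorati determinants and their derivatives\<close>

text \<open>
  Row \<open>j\<close> of the determinant below is column \<open>j\<close> of the matrix in \<^const>\<open>tau\<close>, so that
  differentiation and the Pluecker relation both act on rows.
\<close>

definition casorati :: "nat \<Rightarrow> 'a::real_normed_field family \<Rightarrow> (nat \<Rightarrow> int) \<Rightarrow> int \<Rightarrow> real \<Rightarrow> real \<Rightarrow> 'a" where
  "casorati N \<phi> s k T S = row_det N (\<lambda>j i. \<phi> (Suc i) (s j) k T S)"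

lemma tau_eq_casorati: "tau N \<phi> n k = casorati N \<phi> (\<lambda>j. n + int j) k"
proof (intro ext)
  fix T S
  let ?A = "Matrix.mat N N (\<lambda>(i, j). \<phi> (i + 1) (n + int j) k T S)"
  have "transpose_mat ?A = Matrix.mat N N (\<lambda>(j, i). \<phi> (Suc i) (n + int j) k T S)"
    by (intro eq_matI) auto
  then show "tau N \<phi> n k T S = casorati N \<phi> (\<lambda>j. n + int j) k T S"
    using det_transpose[of ?A N] by (simp add: tau_def casorati_def row_det_def)
qed

lemma casorati_repeated_index:
  assumes "i < N" "j < N" "i \<noteq> j" "s i = s j"
  shows "casorati N \<phi> s k T S = 0"
  unfolding casorati_def using assms by (intro row_det_identical_rows[of i N j]) auto

lemma casorati_has_derivative_T:
  assumes "dispersion_relations N a \<phi>"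
  shows "((\<lambda>t. casorati N \<phi> s k t S) has_vector_derivative
    (\<Sum>l<N. casorati N \<phi> (s(l := s l - 1)) k T S)) (at T)"
proof -
  have "((\<lambda>t. casorati N \<phi> s k t S) has_vector_derivative
    (\<Sum>l<N. row_det N ((\<lambda>j i. \<phi> (Suc i) (s j) k T S)(l := (\<lambda>i. \<phi> (Suc i) (s l - 1) k T S))))) (at T)"
    unfolding casorati_def
    using assms by (intro has_vector_derivative_row_det) (auto simp: dispersion_relations_def)
  moreover have "(\<lambda>j i. \<phi> (Suc i) (s j) k T S)(l := (\<lambda>i. \<phi> (Suc i) (s l - 1) k T S)) =
      (\<lambda>j i. \<phi> (Suc i) ((s(l := s l - 1)) j) k T S)" for l
    by auto
  ultimately show ?thesis by (simp only: casorati_def)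
qed

lemma casorati_has_derivative_S:
  assumes "dispersion_relations N a \<phi>"
  shows "((\<lambda>t. casorati N \<phi> s k T t) has_vector_derivative
    (\<Sum>l<N. casorati N \<phi> (s(l := s l - 2)) k T S)) (at S)"
proof -
  have "((\<lambda>t. casorati N \<phi> s k T t) has_vector_derivative
    (\<Sum>l<N. row_det N ((\<lambda>j i. \<phi> (Suc i) (s j) k T S)(l := (\<lambda>i. \<phi> (Suc i) (s l - 2) k T S))))) (at S)"
    unfolding casorati_def
    using assms by (intro has_vector_derivative_row_det) (auto simp: dispersion_relations_def)
  moreover have "(\<lambda>j i. \<phi> (Suc i) (s j) k T S)(l := (\<lambda>i. \<phi> (Suc i) (s l - 2) k T S)) =
      (\<lambda>j i. \<phi> (Suc i) ((s(l := s l - 2)) j) k T S)" for l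
    by auto
  ultimately show ?thesis by (simp only: casorati_def)
qed

text \<open>The three \<open>lower\<close> determinants carry all derivatives required:
  \<open>tau_T = lower1\<close>, \<open>tau_TT = lower2 + lower11\<close> and
  \<open>tau_S = lower2 - lower11\<close>.\<close>

definition casorati_lower1 ::
  "nat \<Rightarrow> 'a::real_normed_field family \<Rightarrow> int \<Rightarrow> int \<Rightarrow> real \<Rightarrow> real \<Rightarrow> 'a" where
  "casorati_lower1 N \<phi> n = casorati N \<phi> ((\<lambda>j. n + int j)(0 := n - 1))"

definition casorati_lower2 ::
  "nat \<Rightarrow> 'a::real_normed_field family \<Rightarrow> int \<Rightarrow> int \<Rightarrow> real \<Rightarrow> real \<Rightarrow> 'a" where
  "casorati_lower2 N \<phi> n = casorati N \<phi> ((\<lambda>j. n + int j)(0 := n - 2))"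

text \<open>For \<open>N = 1\<close> there is no second column to lower, hence the value \<open>0\<close>.\<close>

definition casorati_lower11 ::
  "nat \<Rightarrow> 'a::real_normed_field family \<Rightarrow> int \<Rightarrow> int \<Rightarrow> real \<Rightarrow> real \<Rightarrow> 'a" where
  "casorati_lower11 N \<phi> n k T S =
    (if N \<ge> 2 then casorati N \<phi> ((\<lambda>j. n + int j)(0 := n - 1, 1 := n)) k T S else 0)"

lemma tau_derivative_T:
  assumes N: "N \<ge> 1" and disp: "dispersion_relations N a \<phi>"
  shows "((\<lambda>t. tau N \<phi> n k t S) has_vector_derivative casorati_lower1 N \<phi> n k T S) (at T)"
proof -
  let ?s = "\<lambda>j. n + int j"
  have zero: "casorati N \<phi> (?s(l := ?s l - 1)) k T S = 0" if "1 \<le> l" "l < N" for l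
    using that by (intro casorati_repeated_index[of l N "l - 1"]) (auto simp: of_nat_diff)
  have "(\<Sum>l<N. casorati N \<phi> (?s(l := ?s l - 1)) k T S) = casorati_lower1 N \<phi> n k T S"
    using zero[of 1] zero by (subst sum_lessThan_first_two[OF N]) (auto simp: casorati_lower1_def)
  then show ?thesis
    using casorati_has_derivative_T[OF disp, of ?s k S T] by (simp add: tau_eq_casorati)
qed

lemma casorati_lower1_derivative_T:
  assumes N: "N \<ge> 1" and disp: "dispersion_relations N a \<phi>"
  shows "((\<lambda>t. casorati_lower1 N \<phi> n k t S) has_vector_derivative
    casorati_lower2 N \<phi> n k T S + casorati_lower11 N \<phi> n k T S) (at T)"
proof -
  let ?s = "(\<lambda>j. n + int j)(0 := n - 1)"
  \<comment> \<open>The vanishing starts only at \<open>l = 2\<close>: index \<open>n + 1\<close> of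
    row 1 drops to \<open>n\<close>, which row 0 has vacated, and this gives
    \<open>lower11\<close>.\<close>
  have zero: "casorati N \<phi> (?s(l := ?s l - 1)) k T S = 0" if "2 \<le> l" "l < N" for l
    using that by (intro casorati_repeated_index[of l N "l - 1"]) (auto simp: of_nat_diff)
  have "(\<Sum>l<N. casorati N \<phi> (?s(l := ?s l - 1)) k T S) =
      casorati_lower2 N \<phi> n k T S + casorati_lower11 N \<phi> n k T S"
    using zero by (subst sum_lessThan_first_two[OF N])
      (auto simp: casorati_lower2_def casorati_lower11_def)
  then show ?thesis
    using casorati_has_derivative_T[OF disp, of ?s k S T] by (simp add: casorati_lower1_def)
qed

lemma tau_derivative_S:
  assumes N: "N \<ge> 1" and disp: "dispersion_relations N a \<phi>"
  shows "((\<lambda>t. tau N \<phi> n k T t) has_vector_derivative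
    casorati_lower2 N \<phi> n k T S - casorati_lower11 N \<phi> n k T S) (at S)"
proof -
  let ?s = "\<lambda>j. n + int j"
  have zero: "casorati N \<phi> (?s(l := ?s l - 2)) k T S = 0" if "2 \<le> l" "l < N" for l
    using that by (intro casorati_repeated_index[of l N "l - 2"]) (auto simp: of_nat_diff)
  \<comment> \<open>Lowering row 1 by two gives the indices \<open>n, n - 1\<close> in the first two
    rows; sorting them costs the minus sign.\<close>
  have one: "casorati N \<phi> (?s(1 := n - 1)) k T S = - casorati_lower11 N \<phi> n k T S" if "N \<ge> 2"
  proof -
    let ?c = "\<lambda>n i. \<phi> (Suc i) n k T S"
    have "casorati N \<phi> (?s(1 := n - 1)) k T S =
        row_det N ((\<lambda>j. ?c (?s j))(0 := ?c n, 1 := ?c (n - 1)))"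
      unfolding casorati_def by (rule row_det_cong) auto
    also have "\<dots> = - row_det N ((\<lambda>j. ?c (?s j))(0 := ?c (n - 1), 1 := ?c n))"
      using that by (intro row_det_swap_rows) auto
    also have "row_det N ((\<lambda>j. ?c (?s j))(0 := ?c (n - 1), 1 := ?c n)) =
        casorati_lower11 N \<phi> n k T S"
      using that by (auto simp: casorati_lower11_def casorati_def intro!: row_det_cong)
    finally show ?thesis .
  qed
  have "(\<Sum>l<N. casorati N \<phi> (?s(l := ?s l - 2)) k T S) =
      casorati_lower2 N \<phi> n k T S - casorati_lower11 N \<phi> n k T S"
    using zero one by (subst sum_lessThan_first_two[OF N])
      (auto simp: casorati_lower2_def casorati_lower11_def)
  then show ?thesis
    using casorati_has_derivative_S[OF disp, of ?s k T S] by (simp add: tau_eq_casorati)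
qed

section \<open>The bilinear equations\<close>

lemma tau_hirota_eq_0:
  assumes N: "N \<ge> 1" and disp: "dispersion_relations N a \<phi>"
    and shift: "\<And>i n T S. i \<in> {1..N} \<Longrightarrow> \<phi> i n k' T S = \<phi> i n k T S - b * \<phi> i (n + 1) k T S"
  shows "hirota (D_T ^ 2 + D_S - [:[:2 * b:]:] * D_T) (tau N \<phi> 1 k) (tau N \<phi> 0 k') T S = 0"
proof -
  define c where "c = (\<lambda>n i. \<phi> (Suc i) n k T S)"
  define d where "d = (\<lambda>n i. c n i - b * c (n + 1) i)"
  define B where "B = (\<lambda>u. row_det N ((\<lambda>j. c (1 + int j))(0 := u)))"
  let ?d = "\<lambda>j. d (int j)"
  have k: "casorati N \<phi> ((\<lambda>j. 1 + int j)(0 := m)) k T S = B (c m)" for m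
    unfolding casorati_def B_def c_def by (rule row_det_cong) auto
  \<comment> \<open>By \<open>shift\<close>, the determinants at site \<open>k'\<close> are built
    from the vectors \<open>d\<close>, hence from the same \<open>c\<close> at site \<open>k\<close>
    as those of \<open>g\<close>.\<close>
  have k': "casorati N \<phi> s k' T S = row_det N (\<lambda>j. d (s j))" for s
    unfolding casorati_def d_def c_def by (rule row_det_cong) (auto simp: shift)
  have g: "tau N \<phi> 1 k T S = B (c 1)"
    using k[of 1] by (simp add: tau_eq_casorati fun_upd_idem)
  have g1: "casorati_lower1 N \<phi> 1 k T S = B (c 0)"
    using k[of 0] by (simp add: casorati_lower1_def)
  have g2: "casorati_lower2 N \<phi> 1 k T S = B (c (- 1))"
    using k[of "- 1"] by (simp add: casorati_lower2_def)
  have f: "tau N \<phi> 0 k' T S = row_det N ?d"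
    by (simp add: tau_eq_casorati k')
  have f1: "casorati_lower1 N \<phi> 0 k' T S = row_det N (?d(0 := d (- 1)))"
    unfolding casorati_lower1_def k' by (rule row_det_cong) auto
  have f2: "casorati_lower11 N \<phi> 0 k' T S =
      (if N \<ge> 2 then row_det N (?d(0 := d (- 1), 1 := d 0)) else 0)"
    unfolding casorati_lower11_def k' by (auto intro!: row_det_cong)
  have "(B (c (- 1)) - b * B (c 0)) * tau N \<phi> 0 k' T S
      - (B (c 0) - b * B (c 1)) * casorati_lower1 N \<phi> 0 k' T S
      + B (c 1) * casorati_lower11 N \<phi> 0 k' T S = 0"
    unfolding f f1 f2 B_def by (rule row_det_bilinear[OF N]) (simp add: d_def)
  note bilinear = this[folded g g1 g2]
  note D = tau_derivative_T[OF N disp] and DD = casorati_lower1_derivative_T[OF N disp]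
    and E = tau_derivative_S[OF N disp]
  \<comment> \<open>In \<open>g_TT + g_S\<close> the \<open>lower11\<close> terms cancel, in
    \<open>f_TT - f_S\<close> the \<open>lower2\<close> terms; what remains is twice the quadratic
    identity.\<close>
  have "hirota (D_T ^ 2 + D_S - [:[:2 * b:]:] * D_T) (tau N \<phi> 1 k) (tau N \<phi> 0 k') T S =
      2 * ((casorati_lower2 N \<phi> 1 k T S - b * casorati_lower1 N \<phi> 1 k T S) * tau N \<phi> 0 k' T S
      - (casorati_lower1 N \<phi> 1 k T S - b * tau N \<phi> 1 k T S) * casorati_lower1 N \<phi> 0 k' T S
      + tau N \<phi> 1 k T S * casorati_lower11 N \<phi> 0 k' T S)"
    unfolding hirota_quadratic hirota_monom_T[OF D D] hirota_monom_TT[OF D DD D DD]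
      hirota_monom_S[OF E E]
    by (simp add: algebra_simps)
  then show ?thesis by (simp add: bilinear)
qed

lemma dispersion_imp_bilinear_equations:
  assumes N: "N \<ge> 1" and a: "a \<noteq> 0" and disp: "dispersion_relations N a \<phi>"
  shows "bilinear_equations a (tau N \<phi> 0) (tau N \<phi> 1)"
proof -
  have "\<phi> i n (k - 1) T S = \<phi> i n k T S - a * \<phi> i (n + 1) k T S" if "i \<in> {1..N}" for i n k T S
  proof -
    have "(\<phi> i n k T S - \<phi> i n (k - 1) T S) / a = \<phi> i (n + 1) k T S"
      using disp that by (simp add: dispersion_relations_def)
    with a show ?thesis by (simp add: field_simps)
  qed
  then have "hirota (D_T ^ 2 + D_S - [:[:2 * a:]:] * D_T) (tau N \<phi> 1 k) (tau N \<phi> 0 (k - 1)) T S = 0"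
    for k T S by (rule tau_hirota_eq_0[OF N disp])
  \<comment> \<open>With \<open>b = 0\<close> and \<open>k' = k\<close> the shift hypothesis is
    trivial and the \<open>D_T\<close> term disappears.\<close>
  moreover have "hirota (D_T ^ 2 + D_S) (tau N \<phi> 1 k) (tau N \<phi> 0 k) T S = 0" for k T S
    using tau_hirota_eq_0[OF N disp, of k k 0 T S] by simp
  ultimately show ?thesis by (simp add: bilinear_equations_def)
qed

section \<open>The soliton solutions\<close>

lemma exp_affine_has_vector_derivative:
  fixes \<alpha> :: "'a::{real_normed_field,banach}"
  shows "((\<lambda>t. exp (\<alpha> * of_real t + \<gamma>)) has_vector_derivative \<alpha> * exp (\<alpha> * of_real x + \<gamma>)) (at x)"
proof -
  have "((\<lambda>t. \<alpha> * of_real t + \<gamma>) has_vector_derivative \<alpha>) (at x)"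
    by (auto intro!: derivative_eq_intros)
  from field_vector_diff_chain_at[OF this DERIV_exp] show ?thesis
    by (simp add: o_def)
qed

lemma two_exp_has_vector_derivative_T:
  fixes \<alpha> :: "'a::{real_normed_field,banach}"
  shows "((\<lambda>t. c * exp (\<alpha> * of_real t + \<beta> * of_real S + \<gamma>) + c' * exp (\<alpha>' * of_real t + \<beta>' * of_real S + \<gamma>'))
    has_vector_derivative c * \<alpha> * exp (\<alpha> * of_real T + \<beta> * of_real S + \<gamma>)
      + c' * \<alpha>' * exp (\<alpha>' * of_real T + \<beta>' * of_real S + \<gamma>')) (at T)"
  unfolding add.assoc mult.assoc
  by (intro has_vector_derivative_add has_vector_derivative_mult_right exp_affine_has_vector_derivative)

lemma two_exp_has_vector_derivative_S:
  fixes \<alpha> :: "'a::{real_normed_field,banach}"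
  shows "((\<lambda>s. c * exp (\<alpha> * of_real T + \<beta> * of_real s + \<gamma>) + c' * exp (\<alpha>' * of_real T + \<beta>' * of_real s + \<gamma>'))
    has_vector_derivative c * \<beta> * exp (\<alpha> * of_real T + \<beta> * of_real S + \<gamma>)
      + c' * \<beta>' * exp (\<alpha>' * of_real T + \<beta>' * of_real S + \<gamma>')) (at S)"
  \<comment> \<open>Moving the \<open>T\<close> term into the constant part makes each exponent
    affine in \<open>s\<close>.\<close>
  unfolding add.assoc mult.assoc add.left_commute[of "_ * of_real T"]
  by (intro has_vector_derivative_add has_vector_derivative_mult_right exp_affine_has_vector_derivative)

lemma smooth_two_exp:
  fixes \<alpha> :: "'a::{real_normed_field,banach}"
  shows "smooth (\<lambda>T S. c * exp (\<alpha> * of_real T + \<beta> * of_real S + \<gamma>)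
    + c' * exp (\<alpha>' * of_real T + \<beta>' * of_real S + \<gamma>'))"
proof -
  have "C_k m (\<lambda>T S. c * exp (\<alpha> * of_real T + \<beta> * of_real S + \<gamma>)
    + c' * exp (\<alpha>' * of_real T + \<beta>' * of_real S + \<gamma>'))" for m
  \<comment> \<open>Both partial derivatives keep the exponents and only change the coefficients, so
    \<open>c\<close> and \<open>c'\<close> must be general.\<close>
  proof (induction m arbitrary: c c')
    case 0
    show ?case
      by (auto simp: case_prod_beta intro!: continuous_intros)
  next
    case (Suc m)
    note T = two_exp_has_vector_derivative_T and S = two_exp_has_vector_derivative_S
    show ?case
      unfolding C_k.simps partial_T_def partial_S_def T[THEN vector_derivative_at] S[THEN vector_derivative_at]
      by (intro conjI allI Suc.IH differentiableI_vector[OF T] differentiableI_vector[OF S])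
  qed
  then show ?thesis by (simp add: smooth_def)
qed

text \<open>These are the dispersion relations for the coefficient of a single exponential. Passing
  to \<open>k - 1\<close> multiplies it by \<open>1 - a * p\<close>, so the difference has the
  factor \<open>a * p\<close>; in the other two, \<open>x\<close> stands for the lattice
  factor.\<close>

lemma soliton_dispersion_coefficient:
  fixes a p :: "'a::field"
  assumes "a \<noteq> 0" "p \<noteq> 0" "a * p \<noteq> 1"
  shows "p powi n * (1 - a * p) powi (- k) - p powi n * (1 - a * p) powi (- (k - 1)) =
      a * (p powi (n + 1) * (1 - a * p) powi (- k))"
    and "p powi n * x * (1 / p) = p powi (n - 1) * x"
    and "p powi n * x * (1 / p\<^sup>2) = p powi (n - 2) * x"
proof -
  have "1 - a * p \<noteq> 0" using assms by simp
  then have "(1 - a * p) powi (- (k - 1)) = (1 - a * p) powi (- k) * (1 - a * p)"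
    using power_int_add_1[of "1 - a * p" "- k"] by (simp add: add.commute)
  then show "p powi n * (1 - a * p) powi (- k) - p powi n * (1 - a * p) powi (- (k - 1)) =
      a * (p powi (n + 1) * (1 - a * p) powi (- k))"
    using power_int_add_1[of p n] assms by (simp only:) (simp add: algebra_simps)
qed (use assms in \<open>simp_all add: power_int_diff\<close>)

lemma smooth_family_soliton: "smooth_family N (soliton a p q \<xi> \<eta>)"
  unfolding smooth_family_def soliton_def by (intro ballI allI smooth_two_exp)

lemma dispersion_relations_soliton:
  fixes a :: "'a::{real_normed_field,banach}"
  assumes a: "a \<noteq> 0"
    and pq: "\<forall>i\<in>{1..N}. p i \<noteq> 0 \<and> q i \<noteq> 0 \<and> a * p i \<noteq> 1 \<and> a * q i \<noteq> 1"
  shows "dispersion_relations N a (soliton a p q \<xi> \<eta>)"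
  unfolding dispersion_relations_def
proof (intro ballI allI conjI)
  fix i n k T S
  assume "i \<in> {1..N}"
  then have p: "p i \<noteq> 0" "a * p i \<noteq> 1" and q: "q i \<noteq> 0" "a * q i \<noteq> 1" using pq by auto
  note P = soliton_dispersion_coefficient[OF a p] and Q = soliton_dispersion_coefficient[OF a q]
  have "soliton a p q \<xi> \<eta> i n k T S - soliton a p q \<xi> \<eta> i n (k - 1) T S =
      (p i powi n * (1 - a * p i) powi (- k) - p i powi n * (1 - a * p i) powi (- (k - 1)))
        * exp (1 / p i * of_real T + 1 / (p i)\<^sup>2 * of_real S + \<xi> i)
      + (q i powi n * (1 - a * q i) powi (- k) - q i powi n * (1 - a * q i) powi (- (k - 1)))
        * exp (1 / q i * of_real T + 1 / (q i)\<^sup>2 * of_real S + \<eta> i)"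
    unfolding soliton_def by (simp only: left_diff_distrib)
      (simp only: diff_conv_add_uminus minus_add_distrib ac_simps)
  also have "\<dots> = a * soliton a p q \<xi> \<eta> i (n + 1) k T S"
    unfolding P(1) Q(1) soliton_def by (simp only: distrib_left mult.assoc)
  finally show "(soliton a p q \<xi> \<eta> i n k T S - soliton a p q \<xi> \<eta> i n (k - 1) T S) / a =
      soliton a p q \<xi> \<eta> i (n + 1) k T S"
    using a by simp
  \<comment> \<open>Read backwards, the coefficient rules turn a lowered power of \<open>p\<close>
    or \<open>q\<close> into the original coefficient times the exponent's rate.\<close>
  show "((\<lambda>t. soliton a p q \<xi> \<eta> i n k t S) has_vector_derivative soliton a p q \<xi> \<eta> i (n - 1) k T S) (at T)"
    unfolding soliton_def P(2)[symmetric] Q(2)[symmetric] by (rule two_exp_has_vector_derivative_T)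
  show "((\<lambda>s. soliton a p q \<xi> \<eta> i n k T s) has_vector_derivative soliton a p q \<xi> \<eta> i (n - 2) k T S) (at S)"
    unfolding soliton_def P(3)[symmetric] Q(3)[symmetric] by (rule two_exp_has_vector_derivative_S)
qed

theorem lemma2:
  fixes N :: nat and a :: "'a::{real_normed_field,banach}"
  assumes "N \<ge> 1" and "a \<noteq> 0"
  shows "(\<forall>\<phi> :: 'a family.
            smooth_family N \<phi> \<longrightarrow> dispersion_relations N a \<phi> \<longrightarrow>
            bilinear_equations a (tau N \<phi> 0) (tau N \<phi> 1)) \<and>
         (\<forall>p q \<xi> \<eta> :: nat \<Rightarrow> 'a.
            (\<forall>i\<in>{1..N}. p i \<noteq> 0 \<and> q i \<noteq> 0 \<and> a * p i \<noteq> 1 \<and> a * q i \<noteq> 1) \<longrightarrow>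
            smooth_family N (soliton a p q \<xi> \<eta>) \<and>
            dispersion_relations N a (soliton a p q \<xi> \<eta>) \<and>
            bilinear_equations a (tau N (soliton a p q \<xi> \<eta>) 0) (tau N (soliton a p q \<xi> \<eta>) 1))"
  using assms dispersion_imp_bilinear_equations[OF assms] smooth_family_soliton
    dispersion_relations_soliton[OF assms(2)]
  by blast

end
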